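(* Let $1\le p_0<\infty$ and let $f$ and $g$ be two positive measurable functions on $\mathbb R^n$ such that, for every pair of weights $(u_1,u_2)\in A_{p_0}$ with $\|(u_1,u_2)\|_{A_{p_0}}=1$, $$\|g\|_{L^{p_0,\infty}(u_2)}\le\|f\|_{L^{p_0}(u_1)} .$$ Then, for every $1<p,q<\infty$ and every pair of weights $(u,v)\in A_{p,q}$ such that $(v^{1-q'},u^{1-p'})\in S_{q',p'}$, we have $$\|g\|_{L^{q,\infty}(v)}\le C\,\|f\|_{L^p(u)},$$ with $C$ depending on $\|(u,v)\|_{A_p}$.
   Context: $M$ is the Hardy–Littlewood maximal operator $Mf(x)=\sup_{x\in Q}\frac1{|Q|}\int_Q|f(y)|\,dy$ (supremum over cubes $Q\subset\mathbb R^n$ containing $x$). $\|g\|_{L^{p,\infty}(w)}=\sup_{y>0}y\,w(\{|g|>y\})^{1/p}$, where $w(E)=\int_E w$, and $\|f\|_{L^p(w)}=(\int|f|^pw)^{1/p}$. For $p\ge1$, a pair of weights (nonnegative measurable functions) $(u,v)$ belongs to the two-weight class $A_p$ (one index) if $\|(u,v)\|_{A_p}=\sup_Q\big(\frac1{|Q|}\int_Q v\big)\big(\frac1{|Q|}\int_Q u^{1-p'}\big)^{p-1}<\infty$, the supremum being over all cubes $Q$ (for $p=1$ the second factor is $\|u^{-1}\|_{L^\infty(Q)}$); this is equivalent to $M:L^p(u)\to L^{p,\infty}(v)$ being bounded. For $0<p,q<\infty$ and positive measurable functions $u,v$: $(u,v)\in A_{p,q}$ (two indices) means that $M:L^p(u)\to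 L^{q,\infty}(v)$ is bounded, and $(u,v)\in S_{p,q}$ means that $M:L^p(u)\to L^q(v)$ is bounded. In the conclusion the weights $u,v$ are positive locally integrable functions. $p'$ denotes the conjugate exponent of $p$, $1/p+1/p'=1$.
   Formalization: C is allowed to depend on the operator norms of (u,v) in A_{p,q} and of (v^{1-q'},u^{1-p'}) in S_{q',p'} as well as on ‖(u,v)‖_{A_p}; dependence on the A_p norm alone fails for q<p (u=1, v=exp(-|tx|), f=g=exp(-|tx|), t→0). *)

theory Defs
  imports "HOL-Analysis.Analysis" "HOL-Probability.Essential_Supremum"
begin

text \<open>Real powers of extended nonnegative reals, with \<open>0\<close> raised to a negative power equal to
  \<open>\<infinity>\<close>.  The library has no such operation, and \<^term>\<open>0 powr a = (0::real)\<close> holds for every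
  \<open>a\<close>, which would be wrong for \<open>u powr (1 - p')\<close> at the zeros of a weight \<open>u\<close>.\<close>

definition enn_powr :: "ennreal \<Rightarrow> real \<Rightarrow> ennreal" where
  "enn_powr x a =
     (if a = 0 then 1
      else if x = 0 then (if a > 0 then 0 else \<infinity>)
      else if x = \<infinity> then (if a > 0 then \<infinity> else 0)
      else ennreal (enn2real x powr a))"

definition conj_exp :: "real \<Rightarrow> real" where
  "conj_exp p = p / (p - 1)"

lemma conj_exp_conjugate: "1 < p \<Longrightarrow> 1 / p + 1 / conj_exp p = 1"
  by (simp add: conj_exp_def field_simps)

definition cubes :: "(real ^ 'n) set set" where
  "cubes = {cbox a (\<chi> i. a $ i + l) | a l. 0 < l}"

definition average :: "(real ^ 'n) set \<Rightarrow> (real ^ 'n \<Rightarrow> ennreal) \<Rightarrow> ennreal" where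
  "average Q F = (\<integral>\<^sup>+x\<in>Q. F x \<partial>lebesgue) / emeasure lebesgue Q"

definition maximal_fun :: "(real ^ 'n \<Rightarrow> real) \<Rightarrow> real ^ 'n \<Rightarrow> ennreal" where
  "maximal_fun f x = (SUP Q\<in>{Q \<in> cubes. x \<in> Q}. average Q (\<lambda>y. ennreal \<bar>f y\<bar>))"

definition weighted_measure :: "(real ^ 'n \<Rightarrow> real) \<Rightarrow> (real ^ 'n) set \<Rightarrow> ennreal" where
  "weighted_measure w E = (\<integral>\<^sup>+x\<in>E. ennreal (w x) \<partial>lebesgue)"

text \<open>The (quasi-)norms act on the pointwise modulus, taken as an extended nonnegative function, so
  that they apply to \<^term>\<open>maximal_fun f\<close> as well as to \<open>\<lambda>x. ennreal \<bar>f x\<bar>\<close> for real \<open>f\<close>.\<close>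

definition Lp_norm :: "real \<Rightarrow> (real ^ 'n \<Rightarrow> real) \<Rightarrow> (real ^ 'n \<Rightarrow> ennreal) \<Rightarrow> ennreal" where
  "Lp_norm p w F = enn_powr (\<integral>\<^sup>+x. enn_powr (F x) p * ennreal (w x) \<partial>lebesgue) (1 / p)"

definition weak_Lp_norm :: "real \<Rightarrow> (real ^ 'n \<Rightarrow> real) \<Rightarrow> (real ^ 'n \<Rightarrow> ennreal) \<Rightarrow> ennreal" where
  "weak_Lp_norm p w F =
     (SUP y\<in>{0::real<..}. ennreal y * enn_powr (weighted_measure w {x. ennreal y < F x}) (1 / p))"

definition weight :: "(real ^ 'n \<Rightarrow> real) \<Rightarrow> bool" where
  "weight w \<longleftrightarrow> w \<in> borel_measurable lebesgue \<and> (\<forall>x. 0 \<le> w x)"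

definition positive_measurable :: "(real ^ 'n \<Rightarrow> real) \<Rightarrow> bool" where
  "positive_measurable w \<longleftrightarrow> w \<in> borel_measurable lebesgue \<and> (\<forall>x. 0 < w x)"

definition locally_integrable :: "(real ^ 'n \<Rightarrow> real) \<Rightarrow> bool" where
  "locally_integrable w \<longleftrightarrow> (\<forall>K. compact K \<longrightarrow> set_integrable lebesgue K w)"

definition Ap_norm :: "real \<Rightarrow> (real ^ 'n \<Rightarrow> real) \<Rightarrow> (real ^ 'n \<Rightarrow> real) \<Rightarrow> ennreal" where
  "Ap_norm p u v =
     (SUP Q\<in>cubes. average Q (\<lambda>x. ennreal (v x)) *
        (if p = 1 then esssup (restrict_space lebesgue Q) (\<lambda>x. enn_powr (ennreal (u x)) (-1))
         else enn_powr (average Q (\<lambda>x. enn_powr (ennreal (u x)) (1 - conj_exp p))) (p - 1)))"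

definition Ap_class :: "real \<Rightarrow> ((real ^ 'n \<Rightarrow> real) \<times> (real ^ 'n \<Rightarrow> real)) set" where
  "Ap_class p = {(u, v). weight u \<and> weight v \<and> Ap_norm p u v < \<infinity>}"

text \<open>Operator norms of the maximal operator from \<open>L\<^sup>p(u)\<close> to weak \<open>L\<^sup>q(v)\<close> and to \<open>L\<^sup>q(v)\<close>;
  boundedness is finiteness of these.\<close>

definition Apq_norm ::
    "real \<Rightarrow> real \<Rightarrow> (real ^ 'n \<Rightarrow> real) \<Rightarrow> (real ^ 'n \<Rightarrow> real) \<Rightarrow> ennreal" where
  "Apq_norm p q u v = Inf {C. \<forall>h \<in> borel_measurable lebesgue.
     weak_Lp_norm q v (maximal_fun h) \<le> C * Lp_norm p u (\<lambda>x. ennreal \<bar>h x\<bar>)}"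

definition Spq_norm ::
    "real \<Rightarrow> real \<Rightarrow> (real ^ 'n \<Rightarrow> real) \<Rightarrow> (real ^ 'n \<Rightarrow> real) \<Rightarrow> ennreal" where
  "Spq_norm p q u v = Inf {C. \<forall>h \<in> borel_measurable lebesgue.
     Lp_norm q v (maximal_fun h) \<le> C * Lp_norm p u (\<lambda>x. ennreal \<bar>h x\<bar>)}"

definition Apq_class ::
    "real \<Rightarrow> real \<Rightarrow> ((real ^ 'n \<Rightarrow> real) \<times> (real ^ 'n \<Rightarrow> real)) set" where
  "Apq_class p q =
     {(u, v). positive_measurable u \<and> positive_measurable v \<and> Apq_norm p q u v < \<infinity>}"

definition Spq_class ::
    "real \<Rightarrow> real \<Rightarrow> ((real ^ 'n \<Rightarrow> real) \<times> (real ^ 'n \<Rightarrow> real)) set" where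
  "Spq_class p q =
     {(u, v). positive_measurable u \<and> positive_measurable v \<and> Spq_norm p q u v < \<infinity>}"

end

theory Submission
  imports Defs
begin

text \<open>Fix a level \<open>y\<close> and a bounded set \<open>E\<close> inside \<open>{g > y, M f \<le> y}\<close> on which \<open>v\<close> is bounded, and
  put \<open>w = v \<chi>\<^sub>E\<close>. The pair \<open>(M w \<cdot> f\<^bsup>1 - p0\<^esup>, w \<cdot> (M f)\<^bsup>1 - p0\<^esup>)\<close> has \<open>A\<^bsub>p0\<^esub>\<close> norm at most \<open>1\<close>; since
  \<open>M f \<le> y\<close> on \<open>E\<close>, the hypothesis applied to it reads \<open>y v(E) \<le> \<integral> f M w\<close>. By Hoelder and the
  \<open>S\<close> condition the right-hand side is at most a constant times
  \<open>\<parallel>f\<parallel> v(E)\<^bsup>1 / q'\<^esup>\<close>, which bounds \<open>y v(E)\<^bsup>1 / q\<^esup>\<close>. The remaining part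
  \<open>{M f > y}\<close> is controlled by the \<open>A\<^bsub>p, q\<^esub>\<close> condition.\<close>

section \<open>Real powers on the extended nonnegative reals\<close>

lemma enn_powr_ennreal: "0 < x \<Longrightarrow> enn_powr (ennreal x) a = ennreal (x powr a)"
  by (auto simp: enn_powr_def)

lemma enn_powr_0 [simp]: "0 < a \<Longrightarrow> enn_powr 0 a = 0"
  by (simp add: enn_powr_def)

lemma enn_powr_top [simp]: "0 < a \<Longrightarrow> enn_powr top a = top"
  by (simp add: enn_powr_def)

lemma enn_powr_1 [simp]: "enn_powr x 1 = x"
  by (cases x) (auto simp: enn_powr_def)

lemma ennreal_0_real_top_cases:
  obtains "x = 0" | r where "0 < r" "x = ennreal r" | "x = (top::ennreal)"
  by (cases x) (metis ennreal_0 less_eq_real_def)+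

text \<open>Valid at \<open>0\<close> and \<open>top\<close> as well, so roots can be removed from
  norm inequalities without finiteness conditions.\<close>

lemma enn_powr_powr_inverse:
  assumes "0 < a"
  shows "enn_powr (enn_powr x a) (1 / a) = x" "enn_powr (enn_powr x (1 / a)) a = x"
  using assms by (cases x rule: ennreal_0_real_top_cases; simp add: enn_powr_ennreal powr_powr)+

lemma enn_powr_mono:
  assumes "0 \<le> a" "x \<le> y"
  shows "enn_powr x a \<le> enn_powr y a"
proof (cases "a = 0")
  case False
  with assms show ?thesis
    by (cases x rule: ennreal_0_real_top_cases; cases y rule: ennreal_0_real_top_cases;
        auto simp: enn_powr_ennreal powr_mono2 top_unique)
qed (simp add: enn_powr_def)

text \<open>The case \<open>x = 0\<close> rests on the convention that \<open>0\<close> to a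
  negative power is \<open>\<infinity>\<close>.\<close>

lemma enn_powr_antimono:
  assumes "a \<le> 0" "x \<le> y"
  shows "enn_powr y a \<le> enn_powr x a"
proof (cases "a = 0")
  case False
  with assms show ?thesis
    by (cases x rule: ennreal_0_real_top_cases; cases y rule: ennreal_0_real_top_cases;
        auto simp: enn_powr_def powr_mono2' top_unique)
qed (simp add: enn_powr_def)

text \<open>For negative exponents this fails at \<open>0 * top\<close>: the left side is
  \<open>\<infinity>\<close>, the right side \<open>\<infinity> * 0 = 0\<close>.\<close>

lemma enn_powr_mult:
  assumes "0 < a"
  shows "enn_powr (x * y) a = enn_powr x a * enn_powr y a"
  using assms
  by (cases x rule: ennreal_0_real_top_cases; cases y rule: ennreal_0_real_top_cases;
      simp add: enn_powr_ennreal powr_mult ennreal_mult_top ennreal_top_mult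
        flip: ennreal_mult)

lemma measurable_enn_powr [measurable]: "(\<lambda>x. enn_powr x a) \<in> borel_measurable borel"
  unfolding enn_powr_def by measurable

section \<open>Cubes and averages\<close>

lemma cubesE:
  fixes Q :: "(real ^ 'n) set"
  assumes "Q \<in> cubes"
  obtains a l where "0 < l" "Q = cbox a (\<chi> i. a $ i + l)"
    "emeasure lebesgue Q = ennreal (l ^ CARD('n))"
proof -
  from assms obtain a l where l: "0 < l" and Q: "Q = cbox a (\<chi> i. a $ i + l)"
    by (auto simp: cubes_def)
  have "cbox a (\<chi> i. a $ i + l) \<noteq> {}"
    using l by (auto simp: box_ne_empty mem_box_cart interval_eq_empty_cart)
  then have "measure lborel Q = l ^ CARD('n)"
    unfolding Q by (simp add: content_cbox_cart)
  moreover have "emeasure lborel Q = ennreal (measure lborel Q)"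
    unfolding Q by (metis emeasure_eq_ennreal_measure emeasure_lborel_cbox_finite less_irrefl infinity_ennreal_def)
  ultimately have "emeasure lebesgue Q = ennreal (l ^ CARD('n))"
    by (simp add: Q)
  with l Q show ?thesis using that by blast
qed

lemma cube_sets [measurable]: "Q \<in> cubes \<Longrightarrow> Q \<in> sets lebesgue"
  by (auto elim: cubesE)

lemma cube_emeasure:
  assumes "Q \<in> cubes"
  shows "0 < emeasure lebesgue Q" "emeasure lebesgue Q < top"
  using assms by (auto elim!: cubesE)

lemma average_mono: "(\<And>x. x \<in> Q \<Longrightarrow> F x \<le> G x) \<Longrightarrow> average Q F \<le> average Q G"
  unfolding average_def by (intro divide_right_mono_ennreal nn_integral_mono) (auto simp: indicator_def)

lemma average_cmult:
  assumes "F \<in> borel_measurable lebesgue" "Q \<in> cubes"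
  shows "average Q (\<lambda>x. c * F x) = c * average Q F"
  using assms unfolding average_def
  by (simp add: mult.assoc nn_integral_cmult ennreal_times_divide)

lemma average_const:
  assumes "Q \<in> cubes"
  shows "average Q (\<lambda>x. c) = c"
  using cube_emeasure[OF assms] assms unfolding average_def
  by (simp add: nn_integral_cmult ennreal_mult_divide_eq)

text \<open>A vanishing integral of a positive function would make \<open>Q\<close> a null set, but
  cubes have positive measure.\<close>

lemma average_pos_if_pos:
  assumes F: "F \<in> borel_measurable lebesgue" and Q: "Q \<in> cubes" and "\<And>x. x \<in> Q \<Longrightarrow> 0 < F x"
  shows "0 < average Q F"
proof -
  have "(\<integral>\<^sup>+x\<in>Q. F x \<partial>lebesgue) \<noteq> 0"
  proof
    assume "(\<integral>\<^sup>+x\<in>Q. F x \<partial>lebesgue) = 0"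
    then have "AE x in lebesgue. F x * indicator Q x = 0"
      using F Q by (subst (asm) nn_integral_0_iff_AE) auto
    then have "AE x in lebesgue. x \<notin> Q"
      by eventually_elim (use assms(3) less_irrefl in \<open>fastforce simp: indicator_def split: if_splits\<close>)
    then have "Q \<in> null_sets lebesgue"
      by (metis AE_iff_null_sets Q cube_sets)
    with cube_emeasure[OF Q] show False by (auto dest: null_setsD1)
  qed
  then show ?thesis
    using cube_emeasure[OF Q] unfolding average_def
    by (simp add: ennreal_zero_less_divide zero_less_iff_neq_zero)
qed

section \<open>The maximal function\<close>

lemma average_le_maximal_fun:
  "Q \<in> cubes \<Longrightarrow> x \<in> Q \<Longrightarrow> average Q (\<lambda>y. ennreal \<bar>f y\<bar>) \<le> maximal_fun f x"
  unfolding maximal_fun_def by (rule SUP_upper) auto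

text \<open>Later gives finiteness of the maximal function of a bounded truncation of
  \<open>v\<close>.\<close>

lemma maximal_fun_le_bound: "(\<And>x. \<bar>f x\<bar> \<le> k) \<Longrightarrow> maximal_fun f x \<le> ennreal k"
  unfolding maximal_fun_def
  by (intro SUP_least) (metis (mono_tags, lifting) average_const average_mono ennreal_leI mem_Collect_eq)

lemma exists_cube_containing: "\<exists>Q \<in> cubes. x \<in> (Q :: (real ^ 'n) set)"
  by (intro bexI[of _ "cbox x (\<chi> i. x $ i + 1)"])
    (auto simp: cubes_def mem_box_cart intro!: exI[of _ x] exI[of _ "1::real"])

text \<open>A cube on which the average exceeds \<open>t\<close> can be enlarged slightly, so every point of
  \<open>{M f > t}\<close>, even one on the boundary of its cube, is interior.\<close>

lemma open_maximal_fun_superlevel: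
  fixes f :: "real ^ 'n \<Rightarrow> real"
  shows "open {x. t < maximal_fun f x}"
proof (subst open_subopen, intro ballI)
  fix x assume "x \<in> {x. t < maximal_fun f x}"
  then obtain Q where Q: "Q \<in> cubes" "x \<in> Q" and t: "t < average Q (\<lambda>y. ennreal \<bar>f y\<bar>)"
    by (auto simp: maximal_fun_def less_SUP_iff)
  obtain a l where l: "0 < l" and Qa: "Q = cbox a (\<chi> i. a $ i + l)"
    and mQ: "emeasure lebesgue Q = ennreal (l ^ CARD('n))"
    using Q(1) by (rule cubesE)
  define I where "I = (\<integral>\<^sup>+y\<in>Q. ennreal \<bar>f y\<bar> \<partial>lebesgue)"
  have tI: "t < I / ennreal (l ^ CARD('n))"
    using t by (simp add: average_def mQ I_def)
  \<comment> \<open>With the integral \<open>I\<close> kept fixed, only the volume in the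
    denominator depends on \<open>e\<close>; it is continuous at \<open>e = 0\<close>, so the strict
    inequality survives for small \<open>e\<close>. If \<open>I = top\<close>, the quotient is
    \<open>top\<close> for every \<open>e\<close>.\<close>
  have "eventually (\<lambda>e. t < I / ennreal ((l + 2 * e) ^ CARD('n))) (at_right (0::real))"
  proof (cases I)
    case (real r)
    have "((\<lambda>e. ennreal (r / (l + 2 * e) ^ CARD('n))) \<longlongrightarrow> ennreal (r / (l + 2 * 0) ^ CARD('n))) (at_right 0)"
      using l by (intro tendsto_intros) auto
    moreover have "t < ennreal (r / (l + 2 * 0) ^ CARD('n))"
      using tI l real by (simp add: divide_ennreal)
    ultimately have "\<forall>\<^sub>F e in at_right 0. t < ennreal (r / (l + 2 * e) ^ CARD('n))"
      by (rule order_tendstoD(1))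
    with eventually_at_right_less show ?thesis
      by eventually_elim (use l real in \<open>simp add: divide_ennreal\<close>)
  next
    case top
    then show ?thesis using tI
      by (auto simp: ennreal_top_divide less_top)
  qed
  with eventually_at_right_less[of "0::real"]
  have "eventually (\<lambda>e. 0 < e \<and> t < I / ennreal ((l + 2 * e) ^ CARD('n))) (at_right (0::real))"
    by eventually_elim auto
  then obtain e where e: "0 < e" "t < I / ennreal ((l + 2 * e) ^ CARD('n))"
    using eventually_happens trivial_limit_at_right_real by blast
  \<comment> \<open>Moving the lower corner by \<open>- e\<close> and lengthening the sides by
    \<open>2 * e\<close> leaves a margin \<open>e\<close> on every face, so \<open>Q\<close> lies in
    the interior of \<open>Q'\<close>.\<close>
  define b where "b = (\<chi> i. a $ i - e)"
  define Q' where "Q' = cbox b (\<chi> i. b $ i + (l + 2 * e))"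
  have Q': "Q' \<in> cubes" unfolding cubes_def Q'_def using l e by (intro CollectI exI[of _ b] exI[of _ "l + 2 * e"]) auto
  \<comment> \<open>Another description of the same cube, needed only for the finiteness of its
    measure.\<close>
  obtain a' l' where a': "0 < l'" "Q' = cbox a' (\<chi> i. a' $ i + l')" "emeasure lebesgue Q' = ennreal (l' ^ CARD('n))"
    using Q' by (rule cubesE)
  have mQ': "emeasure lebesgue Q' = ennreal ((l + 2 * e) ^ CARD('n))"
  proof -
    have "cbox b (\<chi> i. b $ i + (l + 2 * e)) \<noteq> {}"
      using l e by (auto simp: interval_eq_empty_cart)
    then have "measure lborel Q' = (l + 2 * e) ^ CARD('n)"
      unfolding Q'_def by (simp add: content_cbox_cart)
    moreover have "emeasure lebesgue Q' = ennreal (measure lborel Q')"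
      using a' by (simp add: measure_def)
    ultimately show ?thesis by simp
  qed
  have "Q \<subseteq> box b (\<chi> i. b $ i + (l + 2 * e))"
    using e l by (auto simp: Qa b_def mem_box_cart intro: less_le_trans le_less_trans)
      (smt (verit))+
  moreover have sub: "box b (\<chi> i. b $ i + (l + 2 * e)) \<subseteq> Q'"
    unfolding Q'_def by (rule box_subset_cbox)
  ultimately have QQ': "Q \<subseteq> Q'" "x \<in> box b (\<chi> i. b $ i + (l + 2 * e))"
    using Q(2) by auto
  have "I \<le> (\<integral>\<^sup>+y\<in>Q'. ennreal \<bar>f y\<bar> \<partial>lebesgue)"
    unfolding I_def using QQ' by (intro nn_integral_mono) (auto simp: indicator_def)
  then have t': "t < average Q' (\<lambda>y. ennreal \<bar>f y\<bar>)"
    using e(2) unfolding average_def mQ' by (meson divide_right_mono_ennreal less_le_trans)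
  have "box b (\<chi> i. b $ i + (l + 2 * e)) \<subseteq> {x. t < maximal_fun f x}"
    using t' sub average_le_maximal_fun[OF Q'] by (auto intro: less_le_trans)
  with QQ'(2) show "\<exists>T. open T \<and> x \<in> T \<and> T \<subseteq> {x. t < maximal_fun f x}"
    by (intro exI[of _ "box b (\<chi> i. b $ i + (l + 2 * e))"]) (auto intro: open_box)
qed

section \<open>Young's and Hoelder's inequalities\<close>

lemma enn_powr_eq_0_iff: "0 < a \<Longrightarrow> enn_powr x a = 0 \<longleftrightarrow> x = 0"
  by (cases x rule: ennreal_0_real_top_cases) (auto simp: enn_powr_ennreal)

lemma conj_exp_gt_1: "1 < p \<Longrightarrow> 1 < conj_exp p"
  by (simp add: conj_exp_def)

lemma ennreal_Young:
  fixes a b :: ennreal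
  assumes "1 < p" and q_def: "q = conj_exp p"
  shows "a * b \<le> enn_powr a p + enn_powr b q"
proof -
  have q: "1 < q" "1 / p + 1 / q = 1"
    using assms by (simp_all add: conj_exp_gt_1 conj_exp_conjugate)
  \<comment> \<open>A zero factor makes the left side \<open>0\<close>; if neither factor is zero
    and one is infinite, the right side is infinite. Only finite positive values need the real
    inequality.\<close>
  consider "a = 0 \<or> b = 0" | "a \<noteq> 0" "b \<noteq> 0" "a = top \<or> b = top"
    | r s where "0 < r" "a = ennreal r" "0 < s" "b = ennreal s"
    by (cases a rule: ennreal_0_real_top_cases; cases b rule: ennreal_0_real_top_cases) auto
  then show ?thesis
  proof cases
    case 3
    have "r * s \<le> r powr p / p + s powr q / q"
      using 3 assms q by (intro Youngs_inequality) auto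
    also have "\<dots> \<le> r powr p + s powr q"
      using assms q by (intro add_mono) (auto simp: divide_le_eq mult_le_cancel_left1)
    finally show ?thesis
      using 3 by (simp add: enn_powr_ennreal ennreal_leI flip: ennreal_mult ennreal_plus)
  qed (use assms q in auto)
qed

text \<open>Young's inequality is used without the weights \<open>1 / p\<close>, \<open>1 / q\<close>, which costs
  the factor \<open>2\<close>.\<close>

lemma nn_integral_Holder_2:
  assumes p: "1 < p" and q_def: "q = conj_exp p"
    and [measurable]: "f \<in> borel_measurable M" "g \<in> borel_measurable M"
  shows "(\<integral>\<^sup>+x. f x * g x \<partial>M)
    \<le> 2 * (enn_powr (\<integral>\<^sup>+x. enn_powr (f x) p \<partial>M) (1 / p) * enn_powr (\<integral>\<^sup>+x. enn_powr (g x) q \<partial>M) (1 / q))"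
proof -
  have q: "0 < q"
    using p conj_exp_gt_1[of p] by (simp add: q_def)
  define A where "A = enn_powr (\<integral>\<^sup>+x. enn_powr (f x) p \<partial>M) (1 / p)"
  define B where "B = enn_powr (\<integral>\<^sup>+x. enn_powr (g x) q \<partial>M) (1 / q)"
  have A: "(\<integral>\<^sup>+x. enn_powr (f x) p \<partial>M) = enn_powr A p"
    using p by (simp add: A_def enn_powr_powr_inverse)
  have B: "(\<integral>\<^sup>+x. enn_powr (g x) q \<partial>M) = enn_powr B q"
    using q by (simp add: B_def enn_powr_powr_inverse)
  \<comment> \<open>Since \<open>0 * top = 0\<close>, a vanishing norm must be shown to annihilate
    the left side even if the other norm is infinite.\<close>
  have zero: "(\<integral>\<^sup>+x. f x * g x \<partial>M) = 0" if "A = 0 \<or> B = 0"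
  proof -
    have "AE x in M. f x * g x = 0"
      using that
    proof
      assume "A = 0"
      then have "AE x in M. enn_powr (f x) p = 0"
        using A p by (simp add: nn_integral_0_iff_AE)
      then show ?thesis
        by eventually_elim (use p in \<open>simp add: enn_powr_eq_0_iff\<close>)
    next
      assume "B = 0"
      then have "AE x in M. enn_powr (g x) q = 0"
        using B q by (simp add: nn_integral_0_iff_AE)
      then show ?thesis
        by eventually_elim (use q in \<open>simp add: enn_powr_eq_0_iff\<close>)
    qed
    then show ?thesis by (simp add: nn_integral_0_iff_AE)
  qed
  show ?thesis
  proof (cases A rule: ennreal_0_real_top_cases)
    case A0: (2 a)
    show ?thesis
    proof (cases B rule: ennreal_0_real_top_cases)
      case B0: (2 b)
      \<comment> \<open>Both functions are normalised to norm \<open>1\<close>, so that integrating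
        Young's inequality gives \<open>1 + 1\<close>, the source of the factor
        \<open>2\<close>.\<close>
      have 1: "(\<integral>\<^sup>+x. enn_powr (ennreal (1 / a) * f x) p \<partial>M) = 1"
        using A0 A p by (simp add: enn_powr_mult nn_integral_cmult enn_powr_ennreal powr_divide
            flip: ennreal_mult)
      have 2: "(\<integral>\<^sup>+x. enn_powr (ennreal (1 / b) * g x) q \<partial>M) = 1"
        using B0 B q by (simp add: enn_powr_mult nn_integral_cmult enn_powr_ennreal powr_divide
            flip: ennreal_mult)
      have ab: "f x * g x = ennreal (a * b) * ((ennreal (1 / a) * f x) * (ennreal (1 / b) * g x))" for x
      proof -
        have "ennreal (a * b) * ((ennreal (1 / a) * f x) * (ennreal (1 / b) * g x))
           = (ennreal (a * b) * ennreal (1 / a) * ennreal (1 / b)) * (f x * g x)"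
          by (simp add: mult_ac)
        also have "ennreal (a * b) * ennreal (1 / a) * ennreal (1 / b) = 1"
          using A0 B0 by (simp flip: ennreal_mult)
        finally show ?thesis by simp
      qed
      have "(\<integral>\<^sup>+x. f x * g x \<partial>M)
          = ennreal (a * b) * (\<integral>\<^sup>+x. (ennreal (1 / a) * f x) * (ennreal (1 / b) * g x) \<partial>M)"
        unfolding ab by (simp add: nn_integral_cmult)
      also have "\<dots> \<le> ennreal (a * b) *
          (\<integral>\<^sup>+x. enn_powr (ennreal (1 / a) * f x) p + enn_powr (ennreal (1 / b) * g x) q \<partial>M)"
        using p q_def by (intro mult_left_mono nn_integral_mono ennreal_Young) auto
      also have "\<dots> = ennreal (a * b) * 2"
        using 1 2 by (simp add: nn_integral_add)
      also have "\<dots> = 2 * (A * B)"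
        using A0 B0 by (simp add: ennreal_mult mult_ac)
      finally show ?thesis by (simp add: A_def B_def)
    qed (use zero A0 in \<open>auto simp: A_def[symmetric] B_def[symmetric] ennreal_mult_top\<close>)
  qed (use zero in \<open>auto simp: A_def[symmetric] B_def[symmetric] ennreal_top_mult\<close>)
qed

lemma measurable_maximal_fun [measurable]: "maximal_fun f \<in> borel_measurable lebesgue"
proof -
  have "maximal_fun f \<in> borel_measurable borel"
    by (intro borel_measurableI_greater) (simp add: open_maximal_fun_superlevel)
  then show ?thesis by (simp add: measurable_completion)
qed

section \<open>The \<open>A_p\<close> norm and factorised pairs\<close>

text \<open>Used to rescale the second weight until the norm is exactly \<open>1\<close>.\<close>

lemma Ap_norm_cmult:
  assumes "v \<in> borel_measurable lebesgue" "0 \<le> c"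
  shows "Ap_norm p u (\<lambda>x. c * v x) = ennreal c * Ap_norm p u v"
proof -
  have "average Q (\<lambda>x. ennreal (c * v x)) = ennreal c * average Q (\<lambda>x. ennreal (v x))" if "Q \<in> cubes" for Q
    using average_cmult[of "\<lambda>x. ennreal (v x)" Q "ennreal c"] assms that
    by (simp add: ennreal_mult')
  then show ?thesis
    unfolding Ap_norm_def using cubes_def
    by (auto simp: SUP_mult_left_ennreal mult.assoc intro!: SUP_cong)
qed

text \<open>The easy half of the factorisation of weights.\<close>

lemma Ap_norm_factorised_le_1:
  fixes f w :: "real ^ 'n \<Rightarrow> real"
  assumes f: "positive_measurable f" and w: "weight w" and p: "1 \<le> p"
    and Mw: "\<And>x. maximal_fun w x < top"
    and Mf: "\<And>x. 0 < w x \<Longrightarrow> maximal_fun f x < top"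
  shows "Ap_norm p (\<lambda>x. enn2real (maximal_fun w x) * f x powr (1 - p))
           (\<lambda>x. w x * enn2real (maximal_fun f x) powr (1 - p)) \<le> 1"
    (is "Ap_norm p ?u ?v \<le> 1")
  unfolding Ap_norm_def
proof (rule SUP_least)
  fix Q :: "(real ^ 'n) set" assume Q: "Q \<in> cubes"
  have [measurable]: "f \<in> borel_measurable lebesgue" "w \<in> borel_measurable lebesgue"
    and f0: "\<And>x. 0 < f x" and w0: "\<And>x. 0 \<le> w x"
    using f w by (auto simp: positive_measurable_def weight_def)
  define S where "S = (if p = 1 then esssup (restrict_space lebesgue Q) (\<lambda>x. enn_powr (ennreal (?u x)) (-1))
         else enn_powr (average Q (\<lambda>x. enn_powr (ennreal (?u x)) (1 - conj_exp p))) (p - 1))"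
  define a where "a = average Q (\<lambda>x. ennreal (w x))"
  define b where "b = average Q (\<lambda>x. ennreal (f x))"
  have "average Q (\<lambda>x. ennreal (?v x)) * S \<le> 1"
  proof (cases "a = 0")
    \<comment> \<open>Here \<open>w\<close>, and with it the second weight, vanishes almost
      everywhere on \<open>Q\<close>, and \<open>0 * S = 0\<close> even for
      \<open>S = top\<close>.\<close>
    case True
    then have "(\<integral>\<^sup>+x\<in>Q. ennreal (w x) \<partial>lebesgue) = 0"
      using cube_emeasure[OF Q] by (auto simp: a_def average_def ennreal_divide_eq_0_iff)
    then have "AE x in lebesgue. ennreal (w x) * indicator Q x = 0"
      using Q by (subst (asm) nn_integral_0_iff_AE) auto
    then have "AE x in lebesgue. ennreal (?v x) * indicator Q x = 0"
      by eventually_elim (auto simp: indicator_def ennreal_eq_0_iff mult_le_0_iff w0 split: if_splits)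
    then have "(\<integral>\<^sup>+x\<in>Q. ennreal (?v x) \<partial>lebesgue) = 0"
      using Q by (subst nn_integral_0_iff_AE) auto
    then show ?thesis by (simp add: average_def)
  next
    case False
    have "\<exists>x\<in>Q. 0 < w x"
    proof (rule ccontr)
      assume "\<not> ?thesis"
      then have "a \<le> average Q (\<lambda>x. 0)"
        unfolding a_def using w0 by (intro average_mono) (auto simp: not_less ennreal_neg)
      with False show False by (simp add: average_const[OF Q])
    qed
    \<comment> \<open>Finiteness of \<open>maximal_fun f\<close> is assumed only where
      \<open>w\<close> is positive; the point \<open>x0\<close> makes the average \<open>b\<close>
      of \<open>f\<close> finite.\<close>
    then obtain x0 where x0: "x0 \<in> Q" "0 < w x0" by blast
    have b_le: "b \<le> maximal_fun f x" if "x \<in> Q" for x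
      using average_le_maximal_fun[OF Q that, of f] f0 by (simp add: b_def less_imp_le)
    have a_le: "a \<le> maximal_fun w x" if "x \<in> Q" for x
      using average_le_maximal_fun[OF Q that, of w] w0 by (simp add: a_def)
    have "a < top" using a_le[OF x0(1)] Mw le_less_trans by blast
    then obtain a' where a': "a = ennreal a'" "0 < a'"
      using False by (cases a rule: ennreal_0_real_top_cases) auto
    have "b < top" using b_le[OF x0(1)] Mf x0 le_less_trans by blast
    moreover have "0 < b"
      unfolding b_def by (rule average_pos_if_pos) (auto simp: Q f0)
    ultimately obtain b' where b': "b = ennreal b'" "0 < b'"
      by (cases b rule: ennreal_0_real_top_cases) auto
    \<comment> \<open>On \<open>Q\<close> the maximal function of \<open>f\<close> is at least
      \<open>b'\<close>, and the exponent \<open>1 - p\<close> is not positive. Where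
      \<open>w\<close> vanishes there is nothing to show.\<close>
    have "?v x \<le> b' powr (1 - p) * w x" if x: "x \<in> Q" for x
    proof (cases "w x = 0")
      case False
      then have "maximal_fun f x < top" using w0[of x] by (intro Mf) simp
      then have "b' \<le> enn2real (maximal_fun f x)"
        using b_le[OF x] b' by (simp add: enn2real_mono le_ennreal_iff flip: enn2real_ennreal)
          (metis b'(1) b'(2) enn2real_ennreal enn2real_mono less_imp_le)
      then have "enn2real (maximal_fun f x) powr (1 - p) \<le> b' powr (1 - p)"
        using b' p by (intro powr_mono2') auto
      then show ?thesis using w0[of x] by (simp add: mult.commute mult_left_mono)
    qed simp
    then have "average Q (\<lambda>x. ennreal (?v x)) \<le> average Q (\<lambda>x. ennreal (b' powr (1 - p)) * ennreal (w x))"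
      using w0 by (intro average_mono) (simp add: ennreal_leI flip: ennreal_mult)
    also have "\<dots> = ennreal (b' powr (1 - p) * a')"
      using a' by (simp add: average_cmult Q ennreal_mult flip: a_def)
    finally have v_le: "average Q (\<lambda>x. ennreal (?v x)) \<le> ennreal (b' powr (1 - p) * a')" .
    have u_ge: "a' * f x powr (1 - p) \<le> ?u x" if x: "x \<in> Q" for x
    proof -
      have "a' \<le> enn2real (maximal_fun w x)"
        using a_le[OF x] a' Mw[of x] by (metis enn2real_ennreal enn2real_mono less_imp_le)
      then show ?thesis by (intro mult_right_mono) auto
    qed
    \<comment> \<open>One bound serves both forms of the second factor: \<open>r = -1\<close> for
      \<open>p = 1\<close>, where the power of \<open>f\<close> becomes \<open>1\<close>, and
      \<open>r = 1 - conj_exp p\<close> otherwise, where it becomes \<open>f\<close> itself.\<close>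
    have ua: "enn_powr (ennreal (?u x)) r \<le> ennreal (a' powr r) * ennreal (f x powr ((1 - p) * r))"
      if x: "x \<in> Q" and r: "r \<le> 0" for x r
    proof -
      have "enn_powr (ennreal (?u x)) r \<le> enn_powr (ennreal (a' * f x powr (1 - p))) r"
        using r u_ge[OF x] by (intro enn_powr_antimono ennreal_leI)
      also have "\<dots> = ennreal (a' powr r) * ennreal (f x powr ((1 - p) * r))"
        using a' f0[of x] by (subst enn_powr_ennreal) (simp_all add: powr_mult powr_powr ennreal_mult)
      finally show ?thesis .
    qed
    have S_le: "S \<le> ennreal (b' powr (p - 1) / a')"
    proof (cases "p = 1")
      case True
      have "(\<lambda>x. enn_powr (ennreal (?u x)) (-1)) \<in> borel_measurable lebesgue"
        by measurable
      moreover have "enn_powr (ennreal (?u x)) (-1) \<le> ennreal (1 / a')" if "x \<in> Q" for x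
        using ua[OF that, of "-1"] True a' less_imp_neq[OF f0[of x]]
        by (simp add: powr_minus_divide)
      ultimately have "esssup (restrict_space lebesgue Q) (\<lambda>x. enn_powr (ennreal (?u x)) (-1)) \<le> ennreal (1 / a')"
        by (intro esssup_I AE_I2 measurable_restrict_space1) (auto simp: space_restrict_space)
      then show ?thesis using b' by (simp add: S_def True)
    next
      case False
      then have p1: "1 < p" using p by simp
      define r where "r = 1 - conj_exp p"
      have r: "r * (p - 1) = -1" "r < 0" "(1 - p) * r = 1"
        using p1 by (auto simp: r_def conj_exp_def field_simps)
      have "average Q (\<lambda>x. enn_powr (ennreal (?u x)) r)
          \<le> average Q (\<lambda>x. ennreal (a' powr r) * ennreal (f x))"
      proof (rule average_mono)
        fix x assume "x \<in> Q"
        from ua[OF this, of r] r f0[of x]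
        show "enn_powr (ennreal (?u x)) r \<le> ennreal (a' powr r) * ennreal (f x)" by simp
      qed
      also have "\<dots> = ennreal (a' powr r * b')"
        using b' by (simp add: average_cmult Q ennreal_mult flip: b_def)
      finally have "S \<le> enn_powr (ennreal (a' powr r * b')) (p - 1)"
        using p1 False by (simp add: S_def r_def enn_powr_mono)
      also have "\<dots> = ennreal (a' powr (r * (p - 1)) * b' powr (p - 1))"
        using a' b' by (subst enn_powr_ennreal) (simp_all add: powr_mult powr_powr)
      also have "\<dots> = ennreal (b' powr (p - 1) / a')"
        using a' by (simp add: r powr_minus_divide)
      finally show ?thesis .
    qed
    \<comment> \<open>The powers of \<open>b'\<close> and the factors \<open>a'\<close> in the two
      bounds cancel exactly.\<close>
    have "average Q (\<lambda>x. ennreal (?v x)) * S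
        \<le> ennreal (b' powr (1 - p) * a') * ennreal (b' powr (p - 1) / a')"
      using v_le S_le by (intro mult_mono) auto
    also have "\<dots> = ennreal (b' powr (1 - p) * b' powr (p - 1))"
      using a' by (simp flip: ennreal_mult)
    also have "\<dots> = 1"
      using b' by (simp flip: powr_add)
    finally show ?thesis .
  qed
  then show "average Q (\<lambda>x. ennreal (?v x)) *
     (if p = 1 then esssup (restrict_space lebesgue Q) (\<lambda>x. enn_powr (ennreal (?u x)) (-1))
      else enn_powr (average Q (\<lambda>x. enn_powr (ennreal (?u x)) (1 - conj_exp p))) (p - 1)) \<le> 1"
    unfolding S_def .
qed

lemma maximal_fun_pos:
  assumes "positive_measurable f"
  shows "0 < maximal_fun f x"
proof -
  obtain Q where Q: "Q \<in> cubes" "x \<in> Q" using exists_cube_containing by blast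
  have "0 < average Q (\<lambda>y. ennreal \<bar>f y\<bar>)"
    using assms Q(1) by (intro average_pos_if_pos) (auto simp: positive_measurable_def less_le)
  also have "\<dots> \<le> maximal_fun f x" by (rule average_le_maximal_fun[OF Q])
  finally show ?thesis .
qed

text \<open>Makes division by the norm possible. As \<open>u\<close> is finite, its negative powers
  are positive, so the second factor never vanishes; norm \<open>0\<close> would force
  \<open>v = 0\<close> almost everywhere on each cube, hence on the whole space.\<close>

lemma Ap_norm_nonzero:
  fixes u v :: "real ^ 'n \<Rightarrow> real"
  assumes u: "weight u" and v: "weight v" and p: "1 \<le> p"
    and ne: "(\<integral>\<^sup>+x. ennreal (v x) \<partial>lebesgue) \<noteq> 0"
  shows "Ap_norm p u v \<noteq> 0"
proof
  assume 0: "Ap_norm p u v = 0"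
  have [measurable]: "u \<in> borel_measurable lebesgue" "v \<in> borel_measurable lebesgue"
    using u v by (auto simp: weight_def)
  have null: "AE x in lebesgue. ennreal (v x) * indicator Q x = 0" if Q: "Q \<in> cubes" for Q
  proof -
    define S where "S = (if p = 1 then esssup (restrict_space lebesgue Q) (\<lambda>x. enn_powr (ennreal (u x)) (-1))
         else enn_powr (average Q (\<lambda>x. enn_powr (ennreal (u x)) (1 - conj_exp p))) (p - 1))"
    have "average Q (\<lambda>x. ennreal (v x)) * S \<le> Ap_norm p u v"
      unfolding Ap_norm_def S_def using Q by (rule SUP_upper)
    then have prod: "average Q (\<lambda>x. ennreal (v x)) * S = 0" using 0 by simp
    have pos: "0 < enn_powr (ennreal (u x)) r" if "r < 0" for r x
      using that by (cases "ennreal (u x)" rule: ennreal_0_real_top_cases) (auto simp: enn_powr_def)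
    have "S \<noteq> 0"
    proof (cases "p = 1")
      case True
      have "\<not> esssup (restrict_space lebesgue Q) (\<lambda>x. enn_powr (ennreal (u x)) (-1)) \<le> 0"
      proof
        assume le: "esssup (restrict_space lebesgue Q) (\<lambda>x. enn_powr (ennreal (u x)) (-1)) \<le> 0"
        \<comment> \<open>An everywhere positive function would be at most \<open>0\<close> almost
          everywhere on \<open>Q\<close>, so \<open>Q\<close> would be null.\<close>
        have "AE x in restrict_space lebesgue Q. False"
          using esssup_AE[of "\<lambda>x. enn_powr (ennreal (u x)) (-1)" "restrict_space lebesgue Q"]
          by eventually_elim (use le pos[of "-1"] in \<open>metis leD neg_less_0_iff_less order_trans zero_less_one\<close>)
        then have "ae_filter (restrict_space lebesgue Q) = bot"
          by (simp only: trivial_limit_def)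
        then have "emeasure (restrict_space lebesgue Q) Q = 0"
          by (simp add: ae_filter_eq_bot_iff space_restrict_space)
        then show False
          using cube_emeasure[OF Q] Q by (simp add: emeasure_restrict_space)
      qed
      then show ?thesis by (simp add: S_def True)
    next
      case False
      with p have p1: "1 < p" by simp
      have "0 < average Q (\<lambda>x. enn_powr (ennreal (u x)) (1 - conj_exp p))"
        using Q conj_exp_gt_1[OF p1] by (intro average_pos_if_pos pos) auto
      then show ?thesis using p1 by (simp add: S_def enn_powr_eq_0_iff)
    qed
    then have "average Q (\<lambda>x. ennreal (v x)) = 0" using prod by simp
    then have "(\<integral>\<^sup>+x\<in>Q. ennreal (v x) \<partial>lebesgue) = 0"
      using cube_emeasure[OF Q] by (auto simp: average_def ennreal_divide_eq_0_iff)
    then show ?thesis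
      using Q by (subst (asm) nn_integral_0_iff_AE) auto
  qed
  \<comment> \<open>Centred cubes exhausting the space; \<open>Suc k\<close> keeps the side positive
    at \<open>k = 0\<close>.\<close>
  define Q :: "nat \<Rightarrow> (real ^ 'n) set" where
    "Q k = cbox (\<chi> i. - real (Suc k)) (\<chi> i. (\<chi> i. - real (Suc k)) $ i + 2 * real (Suc k))" for k
  have "Q k \<in> cubes" for k
    unfolding Q_def cubes_def mem_Collect_eq
    by (intro exI[of _ "\<chi> i. - real (Suc k)"] exI[of _ "2 * real (Suc k)"]) auto
  then have all: "AE x in lebesgue. \<forall>k. ennreal (v x) * indicator (Q k) x = 0"
    using null by (subst AE_all_countable) blast
  have cover: "\<exists>k. x \<in> Q k" for x
  proof -
    obtain k where k: "norm x \<le> real k" using real_arch_simple by blast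
    have "- real (Suc k) \<le> x $ i \<and> x $ i \<le> - real (Suc k) + 2 * real (Suc k)" for i
      using k component_le_norm_cart[of x i] by (auto simp: abs_le_iff)
    then have "x \<in> Q k"
      unfolding Q_def mem_box_cart vec_lambda_beta by (rule allI)
    then show ?thesis ..
  qed
  have "AE x in lebesgue. ennreal (v x) = 0"
  proof (rule eventually_mono[OF all])
    fix x assume *: "\<forall>k. ennreal (v x) * indicator (Q k) x = 0"
    obtain k where "x \<in> Q k" using cover by blast
    with *[rule_format, of k] show "ennreal (v x) = 0" by simp
  qed
  then have "(\<integral>\<^sup>+x. ennreal (v x) \<partial>lebesgue) = 0"
    by (subst nn_integral_0_iff_AE) auto
  with ne show False ..
qed

section \<open>Testing the hypothesis on a factorised pair\<close>

lemma level_set_estimate: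
  fixes f g w :: "real ^ 'n \<Rightarrow> real"
  assumes p: "1 \<le> p"
    and f: "positive_measurable f" and w: "weight w"
    and Mw: "\<And>x. maximal_fun w x < top"
    and y: "0 < y"
    and supp: "\<And>x. 0 < w x \<Longrightarrow> y < \<bar>g x\<bar> \<and> maximal_fun f x \<le> ennreal y"
    and extr: "\<And>u1 u2. (u1, u2) \<in> Ap_class p \<Longrightarrow> Ap_norm p u1 u2 = 1 \<Longrightarrow>
         weak_Lp_norm p u2 (\<lambda>x. ennreal \<bar>g x\<bar>) \<le> Lp_norm p u1 (\<lambda>x. ennreal \<bar>f x\<bar>)"
  shows "ennreal y * (\<integral>\<^sup>+x. ennreal (w x) \<partial>lebesgue)
    \<le> (\<integral>\<^sup>+x. ennreal (f x) * maximal_fun w x \<partial>lebesgue)"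
proof (cases "(\<integral>\<^sup>+x. ennreal (w x) \<partial>lebesgue) = 0")
  \<comment> \<open>For \<open>\<integral> w = 0\<close> the left side is \<open>0\<close>.
    Otherwise the second weight has nonzero integral, so the norm of the pair can be
    normalised.\<close>
  case False
  define u where "u = (\<lambda>x. enn2real (maximal_fun w x) * f x powr (1 - p))"
  define v where "v = (\<lambda>x. w x * enn2real (maximal_fun f x) powr (1 - p))"
  have [measurable]: "f \<in> borel_measurable lebesgue" "w \<in> borel_measurable lebesgue"
    and f0: "\<And>x. 0 < f x" and w0: "\<And>x. 0 \<le> w x"
    using f w by (auto simp: positive_measurable_def weight_def)
  have uv: "weight u" "weight v"
    unfolding u_def v_def weight_def using w0 by auto
  then have [measurable]: "v \<in> borel_measurable lebesgue" by (simp add: weight_def)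
  \<comment> \<open>On the support of \<open>w\<close> the maximal function of \<open>f\<close> is
    at most \<open>y\<close>, and a nonpositive exponent reverses this.\<close>
  have v_ge: "y powr (1 - p) * w x \<le> v x" for x
  proof (cases "w x = 0")
    case False
    then have "maximal_fun f x \<le> ennreal y" using supp w0[of x] by (simp add: less_le)
    then have "enn2real (maximal_fun f x) \<le> y" "0 < enn2real (maximal_fun f x)"
      using y maximal_fun_pos[OF f, of x]
      by (auto simp: enn2real_leI enn2real_positive_iff intro: le_less_trans)
    then have "y powr (1 - p) \<le> enn2real (maximal_fun f x) powr (1 - p)"
      using p by (intro powr_mono2') auto
    then show ?thesis using w0[of x] by (simp add: v_def mult.commute mult_left_mono)
  qed (simp add: v_def)
  have I_v: "ennreal (y powr (1 - p)) * (\<integral>\<^sup>+x. ennreal (w x) \<partial>lebesgue) \<le> (\<integral>\<^sup>+x. ennreal (v x) \<partial>lebesgue)"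
    using v_ge w0 by (subst nn_integral_cmult[symmetric]) (auto intro!: nn_integral_mono ennreal_leI simp flip: ennreal_mult)
  have "(\<integral>\<^sup>+x. ennreal (v x) \<partial>lebesgue) \<noteq> 0"
    using I_v False y by (auto simp: ennreal_zero_less_mult_iff)
  then have "Ap_norm p u v \<noteq> 0"
    by (intro Ap_norm_nonzero uv p)
  moreover have N_le: "Ap_norm p u v \<le> 1"
    unfolding u_def v_def using f w p Mw supp
    by (intro Ap_norm_factorised_le_1) (auto intro: le_less_trans[OF _ ennreal_less_top])
  ultimately obtain N where N: "Ap_norm p u v = ennreal N" "0 < N" "N \<le> 1"
    by (cases "Ap_norm p u v" rule: ennreal_0_real_top_cases) (auto simp: top_unique)
  \<comment> \<open>The hypothesis needs norm exactly \<open>1\<close>; as \<open>N \<le> 1\<close>, dividing \<open>v\<close> by \<open>N\<close> only increases it.\<close>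
  define v' where "v' = (\<lambda>x. 1 / N * v x)"
  have N': "Ap_norm p u v' = 1"
    unfolding v'_def using N by (subst Ap_norm_cmult) (auto simp flip: ennreal_mult)
  have v': "weight v'" using uv N by (auto simp: v'_def weight_def)
  have "weak_Lp_norm p v' (\<lambda>x. ennreal \<bar>g x\<bar>) \<le> Lp_norm p u (\<lambda>x. ennreal \<bar>f x\<bar>)"
    using N' v' uv by (intro extr) (auto simp: Ap_class_def)
  moreover have "ennreal y * enn_powr (weighted_measure v' {x. ennreal y < ennreal \<bar>g x\<bar>}) (1 / p)
      \<le> weak_Lp_norm p v' (\<lambda>x. ennreal \<bar>g x\<bar>)"
    unfolding weak_Lp_norm_def using y by (intro SUP_upper) auto
  ultimately have "enn_powr (ennreal y * enn_powr (weighted_measure v' {x. ennreal y < ennreal \<bar>g x\<bar>}) (1 / p)) p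
      \<le> enn_powr (Lp_norm p u (\<lambda>x. ennreal \<bar>f x\<bar>)) p"
    using p by (intro enn_powr_mono) auto
  then have main: "ennreal (y powr p) * weighted_measure v' {x. ennreal y < ennreal \<bar>g x\<bar>}
      \<le> (\<integral>\<^sup>+x. enn_powr (ennreal \<bar>f x\<bar>) p * ennreal (u x) \<partial>lebesgue)"
    using p y by (simp add: Lp_norm_def enn_powr_mult enn_powr_powr_inverse enn_powr_ennreal)
  \<comment> \<open>The power \<open>f x powr (1 - p)\<close> in \<open>u\<close> reduces
    \<open>f x powr p\<close> to \<open>f x\<close>, which leaves the integrand of the
    conclusion.\<close>
  have fu: "enn_powr (ennreal \<bar>f x\<bar>) p * ennreal (u x) = ennreal (f x) * maximal_fun w x" for x
  proof -
    have "f x powr p * f x powr (1 - p) = f x"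
      using f0[of x] by (simp flip: powr_add)
    then have "f x powr p * (enn2real (maximal_fun w x) * f x powr (1 - p)) = f x * enn2real (maximal_fun w x)"
      by (metis mult.assoc mult.commute)
    then have "enn_powr (ennreal \<bar>f x\<bar>) p * ennreal (u x) = ennreal (f x * enn2real (maximal_fun w x))"
      using f0[of x] by (simp add: enn_powr_ennreal u_def flip: ennreal_mult)
    then show ?thesis using f0[of x] Mw[of x] by (simp add: ennreal_mult)
  qed
  \<comment> \<open>Restricting to the level set of \<open>g\<close> loses nothing, because
    \<open>v\<close> vanishes wherever \<open>w\<close> does.\<close>
  have "(\<integral>\<^sup>+x. ennreal (v x) \<partial>lebesgue) \<le> weighted_measure v' {x. ennreal y < ennreal \<bar>g x\<bar>}"
    unfolding weighted_measure_def
  proof (rule nn_integral_mono)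
    fix x
    show "ennreal (v x) \<le> ennreal (v' x) * indicator {x. ennreal y < ennreal \<bar>g x\<bar>} x"
    proof (cases "w x = 0")
      case False
      then have "y < \<bar>g x\<bar>" using supp w0[of x] by (simp add: less_le)
      moreover have "v x \<le> v' x"
        using N uv(2) unfolding v'_def by (auto simp: weight_def field_simps mult_left_le_one_le)
      ultimately show ?thesis using y by (simp add: ennreal_leI ennreal_less_iff)
    qed (simp add: v_def)
  qed
  with I_v have "ennreal (y powr p) * (ennreal (y powr (1 - p)) * (\<integral>\<^sup>+x. ennreal (w x) \<partial>lebesgue))
      \<le> ennreal (y powr p) * weighted_measure v' {x. ennreal y < ennreal \<bar>g x\<bar>}"
    by (intro mult_left_mono) auto
  also have "ennreal (y powr p) * (ennreal (y powr (1 - p)) * (\<integral>\<^sup>+x. ennreal (w x) \<partial>lebesgue))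
      = ennreal (y powr p * y powr (1 - p)) * (\<integral>\<^sup>+x. ennreal (w x) \<partial>lebesgue)"
    by (simp add: ennreal_mult mult.assoc)
  also have "y powr p * y powr (1 - p) = y"
    using y by (simp flip: powr_add)
  finally show ?thesis using main by (simp add: fu)
qed simp

section \<open>Duality, operator constants and weak-type bounds\<close>

text \<open>Hoelder's inequality for the splitting of \<open>f * h\<close> into
  \<open>f * u powr (1 / p)\<close> and \<open>u powr (- (1 / p)) * h\<close>. The identity
  \<open>p' / p = p' - 1\<close> produces the dual weight \<open>u powr (1 - p')\<close>.\<close>

lemma nn_integral_mult_le_Lp_norm_dual:
  fixes u f :: "real ^ 'n \<Rightarrow> real"
  assumes p: "1 < p" and u: "positive_measurable u" and f: "positive_measurable f"
    and [measurable]: "h \<in> borel_measurable lebesgue"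
  shows "(\<integral>\<^sup>+x. ennreal (f x) * h x \<partial>lebesgue)
    \<le> 2 * (Lp_norm p u (\<lambda>x. ennreal \<bar>f x\<bar>) * Lp_norm (conj_exp p) (\<lambda>x. u x powr (1 - conj_exp p)) h)"
proof -
  define q where "q = conj_exp p"
  have q: "1 < q" using p by (simp add: q_def conj_exp_gt_1)
  have [measurable]: "u \<in> borel_measurable lebesgue" "f \<in> borel_measurable lebesgue"
    and u0: "\<And>x. 0 < u x" and f0: "\<And>x. 0 < f x"
    using u f by (auto simp: positive_measurable_def)
  have e: "- (1 / p) * q = 1 - q"
    using p by (simp add: q_def conj_exp_def field_simps)
  define F where "F = (\<lambda>x. ennreal (f x) * ennreal (u x powr (1 / p)))"
  define G where "G = (\<lambda>x. ennreal (u x powr (- (1 / p))) * h x)"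
  have F: "enn_powr (F x) p = enn_powr (ennreal \<bar>f x\<bar>) p * ennreal (u x)" for x
    using p u0[of x] f0[of x] by (simp add: F_def enn_powr_mult enn_powr_ennreal powr_powr)
  have G: "enn_powr (G x) q = enn_powr (h x) q * ennreal (u x powr (1 - q))" for x
  proof -
    have "enn_powr (G x) q = ennreal ((u x powr (- (1 / p))) powr q) * enn_powr (h x) q"
      using q u0[of x] by (simp add: G_def enn_powr_mult enn_powr_ennreal)
    then show ?thesis by (simp only: powr_powr e) (rule mult.commute)
  qed
  have "ennreal (f x) * h x = F x * G x" for x
  proof -
    have "F x * G x = ennreal (f x) * (ennreal (u x powr (1 / p)) * ennreal (u x powr (- (1 / p)))) * h x"
      by (simp add: F_def G_def mult_ac)
    also have "ennreal (u x powr (1 / p)) * ennreal (u x powr (- (1 / p))) = 1"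
      using u0[of x] by (simp flip: ennreal_mult powr_add)
    finally show ?thesis by simp
  qed
  then have "(\<integral>\<^sup>+x. ennreal (f x) * h x \<partial>lebesgue) = (\<integral>\<^sup>+x. F x * G x \<partial>lebesgue)" by simp
  also have "\<dots> \<le> 2 * (enn_powr (\<integral>\<^sup>+x. enn_powr (F x) p \<partial>lebesgue) (1 / p)
      * enn_powr (\<integral>\<^sup>+x. enn_powr (G x) q \<partial>lebesgue) (1 / q))"
    by (rule nn_integral_Holder_2[OF p q_def]) (auto simp: F_def G_def)
  finally show ?thesis by (simp add: F G Lp_norm_def flip: q_def)
qed

text \<open>The infimum need not be attained, since \<open>0 * top = 0\<close> while
  \<open>C * top = top\<close> for every positive \<open>C\<close>. Below a finite infimum plus
  \<open>1\<close> there is always an admissible constant.\<close>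

lemma Inf_operator_bound:
  assumes "Inf {C :: ennreal. \<forall>h\<in>A. G h \<le> C * H h} < top" "h \<in> A"
  shows "G h \<le> (Inf {C. \<forall>h\<in>A. G h \<le> C * H h} + 1) * H h"
proof -
  let ?S = "{C. \<forall>h\<in>A. G h \<le> C * H h}"
  have "a < a + 1" if "a < top" for a :: ennreal
    using that ennreal_add_left_cancel_less[of a 0 1] by simp
  from this[OF assms(1)] have "Inf ?S < Inf ?S + 1" .
  then obtain C where "C \<in> ?S" "C < Inf ?S + 1" using Inf_less_iff[of ?S "Inf ?S + 1"] by blast
  then have "G h \<le> C * H h" using assms(2) by blast
  also have "\<dots> \<le> (Inf ?S + 1) * H h"
    by (rule mult_right_mono[OF less_imp_le[OF \<open>C < _\<close>] zero_le])
  finally show ?thesis .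
qed

text \<open>Turns a weak-type inequality at level \<open>y\<close> into a bound on a measure, which
  can be added over sets and passed to increasing unions.\<close>

lemma mult_enn_powr_le_iff:
  assumes "0 < y" "0 < q"
  shows "ennreal y * enn_powr W (1 / q) \<le> B \<longleftrightarrow> W \<le> enn_powr (B / ennreal y) q"
proof
  have cancel: "a * ennreal y / ennreal y = a" for a
    using assms(1) by (intro ennreal_mult_divide_eq) auto
  assume "ennreal y * enn_powr W (1 / q) \<le> B"
  then have "(ennreal y * enn_powr W (1 / q)) / ennreal y \<le> B / ennreal y"
    by (rule divide_right_mono_ennreal)
  then have "enn_powr W (1 / q) \<le> B / ennreal y"
    by (metis cancel mult.commute)
  then have "enn_powr (enn_powr W (1 / q)) q \<le> enn_powr (B / ennreal y) q"
    using assms by (intro enn_powr_mono) auto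
  then show "W \<le> enn_powr (B / ennreal y) q"
    by (simp only: enn_powr_powr_inverse(2)[OF assms(2)])
next
  have cancel: "ennreal y * (B / ennreal y) = B"
    using assms(1) by (metis ennreal_eq_0_iff ennreal_mult_divide_eq ennreal_neq_top ennreal_times_divide mult.commute not_less)
  assume "W \<le> enn_powr (B / ennreal y) q"
  then have "enn_powr W (1 / q) \<le> enn_powr (enn_powr (B / ennreal y) q) (1 / q)"
    using assms by (intro enn_powr_mono) auto
  then have "enn_powr W (1 / q) \<le> B / ennreal y"
    by (simp only: enn_powr_powr_inverse(1)[OF assms(2)])
  then have "ennreal y * enn_powr W (1 / q) \<le> ennreal y * (B / ennreal y)"
    by (rule mult_left_mono) (rule zero_le)
  then show "ennreal y * enn_powr W (1 / q) \<le> B"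
    by (simp only: cancel)
qed

section \<open>Truncated level sets\<close>

text \<open>The bound \<open>k\<close> on \<open>v\<close> makes the maximal function of the
  truncated weight finite; together with the boundedness of \<open>E\<close> it makes
  \<open>v(E)\<close> finite, so that a power of \<open>v(E)\<close> can be cancelled.\<close>

lemma truncated_level_set_estimate:
  fixes f g u v :: "real ^ 'n \<Rightarrow> real"
  assumes p0: "1 \<le> p0" and p: "1 < p" and q: "1 < q"
    and f: "positive_measurable f" and u: "positive_measurable u" and v: "positive_measurable v"
    and extr: "\<And>u1 u2. (u1, u2) \<in> Ap_class p0 \<Longrightarrow> Ap_norm p0 u1 u2 = 1 \<Longrightarrow>
         weak_Lp_norm p0 u2 (\<lambda>x. ennreal \<bar>g x\<bar>) \<le> Lp_norm p0 u1 (\<lambda>x. ennreal \<bar>f x\<bar>)"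
    and K: "\<And>h. h \<in> borel_measurable lebesgue \<Longrightarrow>
      Lp_norm (conj_exp p) (\<lambda>x. u x powr (1 - conj_exp p)) (maximal_fun h)
        \<le> K * Lp_norm (conj_exp q) (\<lambda>x. v x powr (1 - conj_exp q)) (\<lambda>x. ennreal \<bar>h x\<bar>)"
    and y: "0 < y" and k: "0 \<le> k" and E: "E \<in> sets lebesgue"
    and E_sub: "\<And>x. x \<in> E \<Longrightarrow> y < \<bar>g x\<bar> \<and> maximal_fun f x \<le> ennreal y \<and> v x \<le> k \<and> norm x \<le> k"
  shows "ennreal y * enn_powr (weighted_measure v E) (1 / q)
    \<le> 2 * K * Lp_norm p u (\<lambda>x. ennreal \<bar>f x\<bar>)"
proof -
  have [measurable]: "v \<in> borel_measurable lebesgue" and v0: "\<And>x. 0 < v x"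
    using v by (auto simp: positive_measurable_def)
  note [measurable] = E
  define q' where "q' = conj_exp q"
  have q': "1 < q'" "1 / q + 1 / q' = 1"
    using q by (simp_all add: q'_def conj_exp_gt_1 conj_exp_conjugate)
  define w where "w = (\<lambda>x. v x * indicator E x)"
  define V where "V = weighted_measure v E"
  define F where "F = Lp_norm p u (\<lambda>x. ennreal \<bar>f x\<bar>)"
  have w_meas [measurable]: "w \<in> borel_measurable lebesgue"
    unfolding w_def by measurable
  have w: "weight w"
    using v0 by (auto simp: weight_def w_def less_imp_le)
  have w_le: "\<bar>w x\<bar> \<le> k" for x
    using E_sub[of x] v0[of x] k by (auto simp: w_def indicator_def)
  have Mw: "maximal_fun w x < top" for x
    using maximal_fun_le_bound[of w k x, OF w_le] by (auto intro: le_less_trans[OF _ ennreal_less_top])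
  have V: "(\<integral>\<^sup>+x. ennreal (w x) \<partial>lebesgue) = V"
    unfolding V_def weighted_measure_def w_def by (intro nn_integral_cong) (auto simp: indicator_def)
  have "V \<le> (\<integral>\<^sup>+x. ennreal k * indicator (cball (0 :: real ^ 'n) k) x \<partial>lebesgue)"
    unfolding V[symmetric]
  proof (rule nn_integral_mono)
    fix x show "ennreal (w x) \<le> ennreal k * indicator (cball 0 k) x"
      using E_sub[of x] by (cases "x \<in> E") (auto simp: w_def intro!: ennreal_leI)
  qed
  also have "\<dots> = ennreal k * emeasure lebesgue (cball (0 :: real ^ 'n) k)"
    by (rule nn_integral_cmult_indicator) simp
  also have "\<dots> < top"
    using emeasure_lborel_cball_finite[of "0 :: real ^ 'n" k] by (simp add: ennreal_mult_less_top)
  finally have V_fin: "V < top" .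
  have "ennreal y * V \<le> (\<integral>\<^sup>+x. ennreal (f x) * maximal_fun w x \<partial>lebesgue)"
    unfolding V[symmetric]
  proof (rule level_set_estimate[OF p0 f w Mw y _ extr])
    fix x assume "0 < w x"
    then have "x \<in> E" by (cases "x \<in> E") (auto simp: w_def)
    with E_sub show "y < \<bar>g x\<bar> \<and> maximal_fun f x \<le> ennreal y" by blast
  qed
  also have "\<dots> \<le> 2 * (F * Lp_norm (conj_exp p) (\<lambda>x. u x powr (1 - conj_exp p)) (maximal_fun w))"
    unfolding F_def by (rule nn_integral_mult_le_Lp_norm_dual[OF p u f]) measurable
  also have "\<dots> \<le> 2 * (F * (K * Lp_norm q' (\<lambda>x. v x powr (1 - q')) (\<lambda>x. ennreal \<bar>w x\<bar>)))"
    unfolding q'_def by (intro mult_left_mono K w_meas zero_le)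
  \<comment> \<open>On \<open>E\<close> the powers \<open>v powr q'\<close> and
    \<open>v powr (1 - q')\<close> multiply to \<open>v\<close>, so the dual norm of
    \<open>w\<close> is a power of its own mass.\<close>
  also have "Lp_norm q' (\<lambda>x. v x powr (1 - q')) (\<lambda>x. ennreal \<bar>w x\<bar>) = enn_powr V (1 / q')"
  proof -
    have "enn_powr (ennreal \<bar>w x\<bar>) q' * ennreal (v x powr (1 - q')) = ennreal (w x)" for x
    proof (cases "x \<in> E")
      case True
      have "v x powr q' * v x powr (1 - q') = v x"
        using v0[of x] by (simp flip: powr_add)
      with True v0[of x] show ?thesis
        by (simp add: w_def enn_powr_ennreal flip: ennreal_mult)
    qed (use q' in \<open>simp add: w_def\<close>)
    then show ?thesis by (simp add: Lp_norm_def V)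
  qed
  also have "2 * (F * (K * enn_powr V (1 / q'))) = enn_powr V (1 / q') * (2 * K * F)"
    by (simp only: mult_ac)
  finally have le: "ennreal y * V \<le> enn_powr V (1 / q') * (2 * K * F)" .
  \<comment> \<open>Since \<open>1 = 1 / q + 1 / q'\<close>, cancelling
    \<open>enn_powr V (1 / q')\<close> leaves the desired power of \<open>V\<close>; this needs
    \<open>V\<close> positive and finite.\<close>
  have "ennreal y * enn_powr V (1 / q) \<le> 2 * K * F"
  proof (cases V rule: ennreal_0_real_top_cases)
    case 1
    then show ?thesis using q by simp
  next
    case (2 r)
    have "ennreal y * V = enn_powr V (1 / q') * (ennreal y * enn_powr V (1 / q))"
    proof -
      have "enn_powr V (1 / q') * enn_powr V (1 / q) = V"
        using 2 q' by (simp add: enn_powr_ennreal add.commute flip: ennreal_mult powr_add)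
      then show ?thesis by (metis mult.left_commute)
    qed
    moreover have "enn_powr V (1 / q') \<noteq> 0" "enn_powr V (1 / q') \<noteq> top"
      using 2 by (simp_all add: enn_powr_ennreal)
    ultimately show ?thesis using le by (simp add: ennreal_mult_le_mult_iff)
  qed (use V_fin in simp)
  then show ?thesis by (simp only: V_def F_def)
qed

section \<open>Assembling the full level sets\<close>

text \<open>Gives access to subadditivity and continuity from below.\<close>

lemma weighted_measure_eq_density:
  assumes "w \<in> borel_measurable lebesgue" "A \<in> sets lebesgue"
  shows "weighted_measure w A = emeasure (density lebesgue (\<lambda>x. ennreal (w x))) A"
  using assms by (simp add: weighted_measure_def emeasure_density)

lemma two_weight_extrapolation:
  fixes f g u v :: "real ^ 'n \<Rightarrow> real"
  assumes p0: "1 \<le> p0" and p: "1 < p" and q: "1 < q"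
    and f: "positive_measurable f" and g: "positive_measurable g"
    and u: "positive_measurable u" and v: "positive_measurable v"
    and extr: "\<And>u1 u2. (u1, u2) \<in> Ap_class p0 \<Longrightarrow> Ap_norm p0 u1 u2 = 1 \<Longrightarrow>
         weak_Lp_norm p0 u2 (\<lambda>x. ennreal \<bar>g x\<bar>) \<le> Lp_norm p0 u1 (\<lambda>x. ennreal \<bar>f x\<bar>)"
    and K: "\<And>h. h \<in> borel_measurable lebesgue \<Longrightarrow>
      Lp_norm (conj_exp p) (\<lambda>x. u x powr (1 - conj_exp p)) (maximal_fun h)
        \<le> K * Lp_norm (conj_exp q) (\<lambda>x. v x powr (1 - conj_exp q)) (\<lambda>x. ennreal \<bar>h x\<bar>)"
    and L: "weak_Lp_norm q v (maximal_fun f) \<le> L * Lp_norm p u (\<lambda>x. ennreal \<bar>f x\<bar>)"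
  shows "weak_Lp_norm q v (\<lambda>x. ennreal \<bar>g x\<bar>)
    \<le> 2 * (2 * K + L) * Lp_norm p u (\<lambda>x. ennreal \<bar>f x\<bar>)"
  unfolding weak_Lp_norm_def
proof (rule SUP_least)
  fix y :: real assume "y \<in> {0<..}"
  then have y: "0 < y" by simp
  \<comment> \<open>Adding the constants gives one bound for both parts of the level set of
    \<open>g\<close>.\<close>
  define B where "B = (2 * K + L) * Lp_norm p u (\<lambda>x. ennreal \<bar>f x\<bar>)"
  define D where "D = density lebesgue (\<lambda>x. ennreal (v x))"
  have [measurable]: "v \<in> borel_measurable lebesgue" "g \<in> borel_measurable lebesgue"
    using v g by (auto simp: positive_measurable_def)
  define A where "A = {x. ennreal y < ennreal \<bar>g x\<bar>}"
  define H where "H = {x. ennreal y < maximal_fun f x}"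
  \<comment> \<open>These sets increase to the part of the level set where
    \<open>maximal_fun f\<close> is at most \<open>y\<close>, since \<open>v\<close> and the norm
    are finite at every point.\<close>
  define E where "E k = {x. ennreal y < ennreal \<bar>g x\<bar> \<and> maximal_fun f x \<le> ennreal y
      \<and> v x \<le> real k \<and> norm x \<le> real k}" for k :: nat
  have norm_meas [measurable]: "(norm :: real ^ 'n \<Rightarrow> real) \<in> borel_measurable lebesgue"
    by (simp add: measurable_completion)
  have sets: "{x. P x} \<in> sets lebesgue" if "Measurable.pred lebesgue P" for P :: "real ^ 'n \<Rightarrow> bool"
    using that by (simp add: pred_def)
  have A: "A \<in> sets lebesgue" and H: "H \<in> sets lebesgue" and E: "\<And>k. E k \<in> sets lebesgue"
    unfolding A_def H_def E_def by (intro sets; measurable)+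
  have "emeasure D (E k) \<le> enn_powr (B / ennreal y) q" for k
  proof -
    have "ennreal y * enn_powr (weighted_measure v (E k)) (1 / q)
        \<le> 2 * K * Lp_norm p u (\<lambda>x. ennreal \<bar>f x\<bar>)"
      using y by (intro truncated_level_set_estimate[where g = g and k = "real k",
            OF p0 p q f u v extr K y _ E])
        (auto simp: E_def ennreal_less_iff)
    also have "\<dots> \<le> B"
      unfolding B_def by (intro mult_right_mono) (auto simp: le_iff_add)
    finally show ?thesis
      using y q E by (simp add: mult_enn_powr_le_iff weighted_measure_eq_density D_def)
  qed
  moreover have "incseq E"
    unfolding incseq_def E_def by (auto intro: order_trans)
  then have "(SUP k. emeasure D (E k)) = emeasure D (\<Union>k. E k)"
    by (intro SUP_emeasure_incseq) (auto simp: D_def E)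
  \<comment> \<open>The bound does not depend on \<open>k\<close>, so it passes to the
    union.\<close>
  ultimately have DE: "emeasure D (\<Union>k. E k) \<le> enn_powr (B / ennreal y) q"
    by (metis SUP_least)
  have "ennreal y * enn_powr (weighted_measure v H) (1 / q) \<le> weak_Lp_norm q v (maximal_fun f)"
    unfolding weak_Lp_norm_def H_def using y by (intro SUP_upper) auto
  also note L
  also have "L * Lp_norm p u (\<lambda>x. ennreal \<bar>f x\<bar>) \<le> B"
    unfolding B_def by (intro mult_right_mono) auto
  finally have DH: "emeasure D H \<le> enn_powr (B / ennreal y) q"
    using y q H by (simp add: mult_enn_powr_le_iff weighted_measure_eq_density D_def)
  have "A \<subseteq> (\<Union>k. E k) \<union> H"
  proof
    fix x assume x: "x \<in> A"
    obtain k where "max (v x) (norm x) \<le> real k" using real_arch_simple by blast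
    with x show "x \<in> (\<Union>k. E k) \<union> H" by (auto simp: A_def E_def H_def not_less)
  qed
  then have "emeasure D A \<le> emeasure D ((\<Union>k. E k) \<union> H)"
    using E H by (intro emeasure_mono) (auto simp: D_def)
  also have "\<dots> \<le> emeasure D (\<Union>k. E k) + emeasure D H"
    using E H by (intro emeasure_subadditive) (auto simp: D_def)
  also have "\<dots> \<le> enn_powr (B / ennreal y) q + enn_powr (B / ennreal y) q"
    using DE DH by (rule add_mono)
  also have "\<dots> = 2 * enn_powr (B / ennreal y) q"
    by (simp add: mult_2)
  \<comment> \<open>As \<open>q > 1\<close>, the factor \<open>2\<close> from the two parts can be
    moved inside the power, where it doubles \<open>B\<close>.\<close>
  also have "\<dots> \<le> enn_powr 2 q * enn_powr (B / ennreal y) q"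
  proof (rule mult_right_mono)
    have "(2::real) powr 1 \<le> 2 powr q" using q by (intro powr_mono) auto
    then have "ennreal 2 \<le> ennreal (2 powr q)" by (intro ennreal_leI) simp
    also have "\<dots> = enn_powr (ennreal 2) q" by (rule enn_powr_ennreal[symmetric]) simp
    finally show "2 \<le> enn_powr 2 q" by simp
  qed simp
  also have "\<dots> = enn_powr (2 * B / ennreal y) q"
    using q by (simp add: ennreal_times_divide flip: enn_powr_mult)
  also have "2 * B = 2 * (2 * K + L) * Lp_norm p u (\<lambda>x. ennreal \<bar>f x\<bar>)"
    by (simp only: B_def mult.assoc)
  finally show "ennreal y * enn_powr (weighted_measure v {x. ennreal y < ennreal \<bar>g x\<bar>}) (1 / q)
      \<le> 2 * (2 * K + L) * Lp_norm p u (\<lambda>x. ennreal \<bar>f x\<bar>)"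
    using y q A unfolding A_def[symmetric]
    by (simp add: mult_enn_powr_le_iff weighted_measure_eq_density D_def)
qed

theorem theorem3p16:
  fixes p0 p q :: real
  assumes "1 \<le> p0" and "1 < p" and "1 < q"
  shows "\<exists>C :: ennreal \<Rightarrow> ennreal \<Rightarrow> ennreal \<Rightarrow> real.
    \<forall>(f :: real ^ 'n \<Rightarrow> real) g.
      positive_measurable f \<longrightarrow> positive_measurable g \<longrightarrow>
      (\<forall>u1 u2. (u1, u2) \<in> Ap_class p0 \<longrightarrow> Ap_norm p0 u1 u2 = 1 \<longrightarrow>
         weak_Lp_norm p0 u2 (\<lambda>x. ennreal \<bar>g x\<bar>) \<le> Lp_norm p0 u1 (\<lambda>x. ennreal \<bar>f x\<bar>)) \<longrightarrow>
      (\<forall>u v. locally_integrable u \<longrightarrow> locally_integrable v \<longrightarrow>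
         (u, v) \<in> Apq_class p q \<longrightarrow>
         ((\<lambda>x. v x powr (1 - conj_exp q)), (\<lambda>x. u x powr (1 - conj_exp p)))
           \<in> Spq_class (conj_exp q) (conj_exp p) \<longrightarrow>
         weak_Lp_norm q v (\<lambda>x. ennreal \<bar>g x\<bar>)
           \<le> ennreal (C (Ap_norm p u v) (Apq_norm p q u v)
                 (Spq_norm (conj_exp q) (conj_exp p)
                    (\<lambda>x. v x powr (1 - conj_exp q)) (\<lambda>x. u x powr (1 - conj_exp p))))
             * Lp_norm p u (\<lambda>x. ennreal \<bar>f x\<bar>))"
proof (rule exI[of _ "\<lambda>_ a s. enn2real (2 * (2 * (s + 1) + (a + 1)))"], intro allI impI)
  fix f g u v :: "real ^ 'n \<Rightarrow> real"
  define s where "s = Spq_norm (conj_exp q) (conj_exp p)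
     (\<lambda>x. v x powr (1 - conj_exp q)) (\<lambda>x. u x powr (1 - conj_exp p))"
  define a where "a = Apq_norm p q u v"
  assume f: "positive_measurable f" and g: "positive_measurable g"
    and extr: "\<forall>u1 u2. (u1, u2) \<in> Ap_class p0 \<longrightarrow> Ap_norm p0 u1 u2 = 1 \<longrightarrow>
         weak_Lp_norm p0 u2 (\<lambda>x. ennreal \<bar>g x\<bar>) \<le> Lp_norm p0 u1 (\<lambda>x. ennreal \<bar>f x\<bar>)"
    and A: "(u, v) \<in> Apq_class p q"
    and S: "((\<lambda>x. v x powr (1 - conj_exp q)), (\<lambda>x. u x powr (1 - conj_exp p)))
           \<in> Spq_class (conj_exp q) (conj_exp p)"
  have uv: "positive_measurable u" "positive_measurable v" and a: "a < top"
    using A by (auto simp: Apq_class_def a_def)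
  have s: "s < top"
    using S by (auto simp: Spq_class_def s_def)
  \<comment> \<open>The witness is the constant of \<open>two_weight_extrapolation\<close> for
    \<open>K = s + 1\<close> and \<open>L = a + 1\<close>, the admissible constants supplied by
    \<open>Inf_operator_bound\<close>.\<close>
  have "Lp_norm (conj_exp p) (\<lambda>x. u x powr (1 - conj_exp p)) (maximal_fun h)
      \<le> (s + 1) * Lp_norm (conj_exp q) (\<lambda>x. v x powr (1 - conj_exp q)) (\<lambda>x. ennreal \<bar>h x\<bar>)"
    if "h \<in> borel_measurable lebesgue" for h
    using s that unfolding s_def Spq_norm_def by (rule Inf_operator_bound)
  moreover have "weak_Lp_norm q v (maximal_fun f) \<le> (a + 1) * Lp_norm p u (\<lambda>x. ennreal \<bar>f x\<bar>)"
    using a f unfolding a_def Apq_norm_def positive_measurable_def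
    by (intro Inf_operator_bound) auto
  ultimately have "weak_Lp_norm q v (\<lambda>x. ennreal \<bar>g x\<bar>)
      \<le> 2 * (2 * (s + 1) + (a + 1)) * Lp_norm p u (\<lambda>x. ennreal \<bar>f x\<bar>)"
    using extr by (intro two_weight_extrapolation[OF assms f g uv]) auto
  \<comment> \<open>Finiteness matters here: \<open>enn2real\<close> sends \<open>top\<close> to
    \<open>0\<close>.\<close>
  also have "2 * (2 * (s + 1) + (a + 1)) = ennreal (enn2real (2 * (2 * (s + 1) + (a + 1))))"
    using a s by (simp add: ennreal_mult_less_top ennreal_add_less_top less_top)
  finally show "weak_Lp_norm q v (\<lambda>x. ennreal \<bar>g x\<bar>)
      \<le> ennreal (enn2real (2 * (2 * (Spq_norm (conj_exp q) (conj_exp p)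
          (\<lambda>x. v x powr (1 - conj_exp q)) (\<lambda>x. u x powr (1 - conj_exp p)) + 1) + (Apq_norm p q u v + 1))))
        * Lp_norm p u (\<lambda>x. ennreal \<bar>f x\<bar>)"
    by (simp only: a_def s_def)
qed

end
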